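(* Let $(C,\triangle_{k,[r]})$ be a $\mathrm{Dend}_\infty$-coalgebra. Then $(C,\triangle_k)$ is an $A_\infty$-coalgebra, where $$\triangle_k=\triangle_{k,[1]}+\cdots+\triangle_{k,[k]},\quad\text{for }1\le k<\infty.$$
   Context: All vector spaces, linear maps and tensor products are over a field $\mathbb K$ of characteristic zero; graded maps follow the Koszul sign convention. An $A_\infty$-coalgebra is a graded vector space $C=\bigoplus C_i$ with linear maps $\triangle_k:C\to C^{\otimes k}$ of degree $k-2$, $k\ge1$, satisfying for all $n\ge1$ $$\sum_{r+s+t=n,\ r,t\ge0,\ s\ge1}(-1)^{rs+t}(\mathrm{id}^{\otimes r}\otimes\triangle_s\otimes\mathrm{id}^{\otimes t})\circ\triangle_{r+1+t}=0.$$ $C_n=\{[1],\dots,[n]\}$ (a set of labels) and $\mathbb K[C_n]$ is the vector space with basis $C_n$. For $m,n\ge1$, $1\le i\le m$ define $R_0^{m,i,n}:C_{m+n-1}\to C_m$ by $[r]\mapsto[r]$ if $r\le i-1$, $[r]\mapsto[i]$ if $i\le r\le i+n-1$, $[r]\mapsto[r-n+1]$ if $i+n\le r\le m+n-1$; and $R_1^{m,i,n}:C_{m+n-1}\to\mathbb K[C_n]$ by $[r]\mapsto[r-i+1]$ if $i\le r\le i+n-1$ and $[r]\mapsto[1]+\cdots+[n]$ otherwise. Set $\triangle_{k,[r_1]+\cdots+[r_p]}=\triangle_{k,[r_1]}+\cdots+\triangle_{k,[r_p]}$. A $\mathrm{Dend}_\infty$-coalgebra is a graded vector space $C=\bigoplus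 C_i$ with graded linear maps $\triangle_{k,[r]}:C\to C^{\otimes k}$ of degree $k-2$, for $[r]\in C_k$, $1\le k<\infty$, satisfying for all $n\ge1$ and $[\theta]\in C_n$ $$\sum_{r+s+t=n,\ r,t\ge0,\ s\ge1}(-1)^{rs+t}(\mathrm{id}^{\otimes r}\otimes\triangle_{s,R_1^{r+1+t,r+1,s}[\theta]}\otimes\mathrm{id}^{\otimes t})\circ\triangle_{r+1+t,R_0^{r+1+t,r+1,s}[\theta]}=0.$$ *)

theory Defs
  imports "HOL.Vector_Spaces" "HOL-Library.Function_Algebras" "HOL-Library.Poly_Mapping"
begin

section \<open>Tensor powers of a vector space\<close>

text \<open>
  The tensor power of order \<open>k\<close> of a vector space \<open>C\<close> over a field \<open>K\<close> is modelled as the span of the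
  evaluation functionals \<open>\<phi> \<mapsto> \<phi>(x\<^sub>1, \<dots>, x\<^sub>k)\<close> inside the space of all \<open>K\<close>-valued functions of the
  \<open>k\<close>-linear forms \<open>\<phi>\<close>.  The lemmas \<open>multilinear_ptensor\<close>, \<open>linear_tensor_lift\<close>,
  \<open>tensor_lift_ptensor\<close> and \<open>tensor_power_linear_eq\<close> are the universal property of the tensor
  power; the definitions of the later sections use the construction only through it.
  Lists \<open>[x\<^sub>1, \<dots>, x\<^sub>k]\<close> stand for \<open>k\<close>-tuples.
\<close>

type_synonym ('k, 'v) tensor = "('v list \<Rightarrow> 'k) \<Rightarrow> 'k"

definition tensor_scale :: "'k::field \<Rightarrow> ('k, 'v) tensor \<Rightarrow> ('k, 'v) tensor"  (infixr \<open>*\<^sub>T\<close> 75)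
  where "c *\<^sub>T T = (\<lambda>\<phi>. c * T \<phi>)"

interpretation tensor: vector_space "tensor_scale :: 'k::field \<Rightarrow> ('k, 'v) tensor \<Rightarrow> ('k, 'v) tensor"
  by standard (auto simp: tensor_scale_def fun_eq_iff algebra_simps)

definition multilinear ::
    "('k::field \<Rightarrow> 'v::ab_group_add \<Rightarrow> 'v) \<Rightarrow> ('k \<Rightarrow> 'w::ab_group_add \<Rightarrow> 'w) \<Rightarrow> nat \<Rightarrow> ('v list \<Rightarrow> 'w) \<Rightarrow> bool"
  where "multilinear scaleV scaleW k f \<longleftrightarrow>
    (\<forall>xs ys. Suc (length xs + length ys) = k \<longrightarrow>
       Vector_Spaces.linear scaleV scaleW (\<lambda>x. f (xs @ x # ys)))"

lemma field_vector_space: "vector_space ((*) :: 'k::field \<Rightarrow> 'k \<Rightarrow> 'k)"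
  by standard (auto simp: algebra_simps)

lemma ex_linear_functional_nonzero:
  assumes "vector_space (scaleW :: 'k::field \<Rightarrow> 'w::ab_group_add \<Rightarrow> 'w)" "w \<noteq> 0"
  shows "\<exists>h. Vector_Spaces.linear scaleW (*) h \<and> h w \<noteq> 0"
proof -
  interpret W: vector_space scaleW by fact
  interpret K: vector_space "(*) :: 'k \<Rightarrow> 'k \<Rightarrow> 'k" by (rule field_vector_space)
  interpret WK: vector_space_pair scaleW "(*)" ..
  have ind: "W.independent {w}" using assms(2) by simp
  have "WK.construct {w} (\<lambda>_. 1) w = 1" by (rule WK.construct_basis[OF ind]) simp
  then show ?thesis using WK.linear_construct[OF ind] zero_neq_one by metis
qed

context vector_space
begin

definition ptensor :: "'b list \<Rightarrow> ('a, 'b) tensor"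
  where "ptensor xs = (\<lambda>\<phi>. if multilinear scale (*) (length xs) \<phi> then \<phi> xs else 0)"

definition tensor_power :: "nat \<Rightarrow> ('a, 'b) tensor set"
  where "tensor_power k = tensor.span (ptensor ` {xs. length xs = k})"

text \<open>The linear map on the tensor power of order \<open>k\<close> induced by a \<open>k\<close>-linear map \<open>f\<close>.\<close>

definition tensor_lift ::
    "('a \<Rightarrow> 'w::ab_group_add \<Rightarrow> 'w) \<Rightarrow> nat \<Rightarrow> ('b list \<Rightarrow> 'w) \<Rightarrow> ('a, 'b) tensor \<Rightarrow> 'w"
  where "tensor_lift scaleW k f =
    (SOME L. Vector_Spaces.linear tensor_scale scaleW L \<and>
       (\<forall>xs. length xs = k \<longrightarrow> L (ptensor xs) = f xs))"

lemma ptensor_in_tensor_power: "ptensor xs \<in> tensor_power (length xs)"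
  by (auto simp: tensor_power_def intro: tensor.span_base)

lemma multilinear_ptensor: "multilinear scale tensor_scale k ptensor"
  unfolding multilinear_def
proof (intro allI impI)
  fix xs ys :: "'b list"
  assume k: "Suc (length xs + length ys) = k"
  have "ptensor (xs @ (x + y) # ys) = ptensor (xs @ x # ys) + ptensor (xs @ y # ys)" for x y
  proof
    fix \<phi> :: "'b list \<Rightarrow> 'a"
    show "ptensor (xs @ (x + y) # ys) \<phi> = (ptensor (xs @ x # ys) + ptensor (xs @ y # ys)) \<phi>"
    proof (cases "multilinear scale (*) k \<phi>")
      case True
      then interpret L: Vector_Spaces.linear scale "(*)" "\<lambda>x. \<phi> (xs @ x # ys)"
        using k unfolding multilinear_def by blast
      show ?thesis using True k L.add by (simp add: ptensor_def)
    qed (use k in \<open>simp add: ptensor_def\<close>)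
  qed
  moreover have "ptensor (xs @ scale c x # ys) = c *\<^sub>T ptensor (xs @ x # ys)" for c x
  proof
    fix \<phi> :: "'b list \<Rightarrow> 'a"
    show "ptensor (xs @ scale c x # ys) \<phi> = (c *\<^sub>T ptensor (xs @ x # ys)) \<phi>"
    proof (cases "multilinear scale (*) k \<phi>")
      case True
      then interpret L: Vector_Spaces.linear scale "(*)" "\<lambda>x. \<phi> (xs @ x # ys)"
        using k unfolding multilinear_def by blast
      show ?thesis using True k L.scale by (simp add: ptensor_def tensor_scale_def)
    qed (use k in \<open>simp add: ptensor_def tensor_scale_def\<close>)
  qed
  ultimately show "Vector_Spaces.linear scale tensor_scale (\<lambda>x. ptensor (xs @ x # ys))"
    by unfold_locales auto
qed

lemma ex_tensor_lift:
  assumes W: "vector_space scaleW" and f: "multilinear scale scaleW k f"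
  shows "\<exists>L. Vector_Spaces.linear tensor_scale scaleW L \<and>
    (\<forall>xs. length xs = k \<longrightarrow> L (ptensor xs) = f xs)"
proof -
  interpret W: vector_space scaleW by fact
  interpret TW: vector_space_pair "tensor_scale :: 'a \<Rightarrow> ('a, 'b) tensor \<Rightarrow> _" scaleW ..
  let ?P = "ptensor ` {xs. length xs = k}"
  obtain B where B: "B \<subseteq> ?P" "tensor.independent B" "?P \<subseteq> tensor.span B"
    using tensor.maximal_independent_subset by blast
  define ws where "ws b = (SOME xs. length xs = k \<and> ptensor xs = b)" for b
  have ws: "length (ws b) = k \<and> ptensor (ws b) = b" if "b \<in> B" for b
    unfolding ws_def by (rule someI_ex) (use that B(1) in auto)
  define L where "L = TW.construct B (\<lambda>b. f (ws b))"
  interpret L: Vector_Spaces.linear tensor_scale scaleW L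
    unfolding L_def by (rule TW.linear_construct) fact
  have Lb: "L b = f (ws b)" if "b \<in> B" for b
    unfolding L_def by (rule TW.construct_basis) (use B that in auto)
  have "L (ptensor xs) = f xs" if len: "length xs = k" for xs
  proof (rule ccontr)
    assume neq: "L (ptensor xs) \<noteq> f xs"
    have "ptensor xs \<in> tensor.span B" using B(3) len by blast
    then obtain S c where S: "finite S" "S \<subseteq> B" and eq: "ptensor xs = (\<Sum>b\<in>S. c b *\<^sub>T b)"
      unfolding tensor.span_explicit by auto
    have Lxs: "L (ptensor xs) = (\<Sum>b\<in>S. scaleW (c b) (f (ws b)))"
      unfolding eq L.sum L.scale using S Lb by (intro sum.cong) auto
    obtain h where h: "Vector_Spaces.linear scaleW (*) h" "h (L (ptensor xs) - f xs) \<noteq> 0"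
      using ex_linear_functional_nonzero[OF W] neq by (metis right_minus_eq)
    interpret h: Vector_Spaces.linear scaleW "(*)" h by fact
    have hf: "multilinear scale (*) k (h \<circ> f)"
      unfolding multilinear_def
    proof (intro allI impI)
      fix us vs :: "'b list"
      assume "Suc (length us + length vs) = k"
      then have "Vector_Spaces.linear scale scaleW (\<lambda>x. f (us @ x # vs))"
        using f unfolding multilinear_def by blast
      from Vector_Spaces.linear_compose[OF this h(1)]
      show "Vector_Spaces.linear scale (*) (\<lambda>x. (h \<circ> f) (us @ x # vs))"
        by (simp add: o_def)
    qed
    have sum_app: "(\<Sum>b\<in>S. F b) \<phi> = (\<Sum>b\<in>S. F b \<phi>)" for F :: "_ \<Rightarrow> ('a, 'b) tensor" and \<phi>
      using S(1) by (induction S) auto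
    have "h (f xs) = ptensor xs (h \<circ> f)" using hf len by (simp add: ptensor_def)
    also have "\<dots> = (\<Sum>b\<in>S. c b * b (h \<circ> f))"
      by (subst eq) (simp add: sum_app tensor_scale_def)
    also have "\<dots> = (\<Sum>b\<in>S. c b * h (f (ws b)))"
    proof (rule sum.cong[OF refl])
      fix b assume "b \<in> S"
      then have len: "length (ws b) = k" and eq: "ptensor (ws b) = b" using ws S(2) by blast+
      have "ptensor (ws b) (h \<circ> f) = h (f (ws b))" using hf len by (simp add: ptensor_def)
      then have "b (h \<circ> f) = h (f (ws b))" unfolding eq .
      then show "c b * b (h \<circ> f) = c b * h (f (ws b))" by simp
    qed
    also have "\<dots> = h (L (ptensor xs))" by (simp add: Lxs h.sum h.scale)
    finally show False using h(2) h.diff by simp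
  qed
  then show ?thesis using L.linear_axioms by blast
qed

lemma
  assumes "vector_space scaleW" "multilinear scale scaleW k f"
  shows linear_tensor_lift: "Vector_Spaces.linear tensor_scale scaleW (tensor_lift scaleW k f)"
    and tensor_lift_ptensor: "length xs = k \<Longrightarrow> tensor_lift scaleW k f (ptensor xs) = f xs"
  using someI_ex[OF ex_tensor_lift[OF assms]] unfolding tensor_lift_def by auto

lemma tensor_power_linear_eq:
  assumes L: "Vector_Spaces.linear tensor_scale scaleW L" "Vector_Spaces.linear tensor_scale scaleW M"
    and eq: "\<And>xs. length xs = k \<Longrightarrow> L (ptensor xs) = M (ptensor xs)"
    and a: "a \<in> tensor_power k"
  shows "L a = M a"
proof -
  interpret L: Vector_Spaces.linear tensor_scale scaleW L by fact
  interpret M: Vector_Spaces.linear tensor_scale scaleW M by fact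
  interpret P: vector_space_pair "tensor_scale :: 'a \<Rightarrow> ('a, 'b) tensor \<Rightarrow> _" scaleW ..
  show ?thesis
    by (rule P.linear_eq_on[OF L a[unfolded tensor_power_def]]) (use eq in auto)
qed

text \<open>\<open>tensor_insert s [x\<^sub>1, \<dots>, x\<^sub>r] [y\<^sub>1, \<dots>, y\<^sub>t] a\<close> is \<open>x\<^sub>1 \<otimes> \<dots> \<otimes> x\<^sub>r \<otimes> a \<otimes> y\<^sub>1 \<otimes> \<dots> \<otimes> y\<^sub>t\<close>
  for \<open>a\<close> in the tensor power of order \<open>s\<close>.\<close>

definition tensor_insert :: "nat \<Rightarrow> 'b list \<Rightarrow> 'b list \<Rightarrow> ('a, 'b) tensor \<Rightarrow> ('a, 'b) tensor"
  where "tensor_insert s xs ys = tensor_lift tensor_scale s (\<lambda>zs. ptensor (xs @ zs @ ys))"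

lemma multilinear_ptensor_insert:
  "multilinear scale tensor_scale s (\<lambda>zs. ptensor (xs @ zs @ ys))"
  unfolding multilinear_def
proof (intro allI impI)
  fix us vs :: "'b list"
  show "Vector_Spaces.linear scale tensor_scale (\<lambda>z. ptensor (xs @ (us @ z # vs) @ ys))"
    using multilinear_ptensor[unfolded multilinear_def, rule_format, of "xs @ us" "vs @ ys", OF refl]
    by simp
qed

lemma linear_tensor_insert: "Vector_Spaces.linear tensor_scale tensor_scale (tensor_insert s xs ys)"
  unfolding tensor_insert_def
  by (rule linear_tensor_lift[OF tensor.vector_space_axioms multilinear_ptensor_insert])

lemma tensor_insert_ptensor:
  "length zs = s \<Longrightarrow> tensor_insert s xs ys (ptensor zs) = ptensor (xs @ zs @ ys)"
  unfolding tensor_insert_def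
  by (rule tensor_lift_ptensor[OF tensor.vector_space_axioms multilinear_ptensor_insert])

end


section \<open>Graded vector spaces\<close>

text \<open>\<open>C\<close> is the whole type \<open>'v\<close>, and \<open>G i\<close> is its homogeneous component \<open>C\<^sub>i\<close>; the last assumption
  says that \<open>C\<close> is the direct sum of the \<open>C\<^sub>i\<close>.\<close>

locale graded_vector_space = vector_space scale
  for scale :: "'k::field_char_0 \<Rightarrow> 'v::ab_group_add \<Rightarrow> 'v"  (infixr \<open>*\<^sub>C\<close> 75) +
  fixes G :: "int \<Rightarrow> 'v set"
  assumes subspace_component: "subspace (G i)"
    and direct_sum:
      "\<exists>!c. (\<forall>i. c i \<in> G i) \<and> finite {i. c i \<noteq> 0} \<and> x = (\<Sum>i | c i \<noteq> 0. c i)"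
begin

definition component :: "'v \<Rightarrow> int \<Rightarrow> 'v"
  where "component x =
    (THE c. (\<forall>i. c i \<in> G i) \<and> finite {i. c i \<noteq> 0} \<and> x = (\<Sum>i | c i \<noteq> 0. c i))"

text \<open>The homogeneous part of degree \<open>d\<close> of the tensor power of order \<open>k\<close>.\<close>

definition tensor_power_degree :: "nat \<Rightarrow> int \<Rightarrow> ('k, 'v) tensor set"
  where "tensor_power_degree k d =
    tensor.span {ptensor xs | xs ds.
      length xs = k \<and> list_all2 (\<lambda>x i. x \<in> G i) xs ds \<and> sum_list ds = d}"

definition graded_linear_map :: "nat \<Rightarrow> int \<Rightarrow> ('v \<Rightarrow> ('k, 'v) tensor) \<Rightarrow> bool"
  where "graded_linear_map k d f \<longleftrightarrow>
    Vector_Spaces.linear scale tensor_scale f \<and>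
    (\<forall>x. f x \<in> tensor_power k) \<and>
    (\<forall>i. \<forall>x\<in>G i. f x \<in> tensor_power_degree k (i + d))"

text \<open>
  The Koszul rule for a map \<open>f\<close> of degree \<open>d\<close> moving past homogeneous elements:
  \<open>(id\<^sup>r \<otimes> f \<otimes> id\<^sup>t) (x\<^sub>1 \<otimes> \<dots> \<otimes> x\<^sub>r \<otimes> x \<otimes> y\<^sub>1 \<otimes> \<dots> \<otimes> y\<^sub>t)
    = (-1)\<^bsup>d(|x\<^sub>1| + \<dots> + |x\<^sub>r|)\<^esup> x\<^sub>1 \<otimes> \<dots> \<otimes> x\<^sub>r \<otimes> f x \<otimes> y\<^sub>1 \<otimes> \<dots> \<otimes> y\<^sub>t\<close>.
  The factor \<open>(-1)\<^bsup>d|x\<^sub>j|\<^esup>\<close> of each \<open>x\<^sub>j\<close> is extended linearly to inhomogeneous elements by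
  \<open>koszul\<close>; see \<open>id_tensor_id_homogeneous\<close> for the rule in the above form.
\<close>

definition koszul :: "int \<Rightarrow> 'v \<Rightarrow> 'v"
  where "koszul d x = (\<Sum>i | component x i \<noteq> 0. ((- 1) powi (d * i)) *\<^sub>C component x i)"

definition id_tensor_id ::
    "nat \<Rightarrow> nat \<Rightarrow> int \<Rightarrow> ('v \<Rightarrow> ('k, 'v) tensor) \<Rightarrow> nat \<Rightarrow> ('k, 'v) tensor \<Rightarrow> ('k, 'v) tensor"
  where "id_tensor_id r s d f t =
    tensor_lift tensor_scale (r + 1 + t)
      (\<lambda>xs. tensor_insert s (map (koszul d) (take r xs)) (drop (Suc r) xs) (f (xs ! r)))"

lemma component:
  "component x i \<in> G i" "finite {i. component x i \<noteq> 0}"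
  "x = (\<Sum>i | component x i \<noteq> 0. component x i)"
  using theI'[OF direct_sum[of x]] unfolding component_def[symmetric] by auto

lemma component_eqI:
  assumes "\<And>i. c i \<in> G i" "finite A" "\<And>i. i \<notin> A \<Longrightarrow> c i = 0" "x = (\<Sum>i\<in>A. c i)"
  shows "component x = c"
proof -
  have sub: "{i. c i \<noteq> 0} \<subseteq> A" using assms(3) by auto
  have "x = (\<Sum>i | c i \<noteq> 0. c i)"
    unfolding assms(4) by (rule sum.mono_neutral_right) (use sub assms(2) in auto)
  then show ?thesis
    unfolding component_def using assms(1) finite_subset[OF sub assms(2)]
    by (intro the1_equality[OF direct_sum]) auto
qed

lemma component_sum:
  assumes "finite A" "{i. component x i \<noteq> 0} \<subseteq> A"
  shows "x = (\<Sum>i\<in>A. component x i)"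
proof -
  have "(\<Sum>i | component x i \<noteq> 0. component x i) = (\<Sum>i\<in>A. component x i)"
    by (rule sum.mono_neutral_left) (use assms in auto)
  then show ?thesis using component(3)[of x] by simp
qed

lemma koszul_eq:
  assumes "finite A" "{i. component x i \<noteq> 0} \<subseteq> A"
  shows "koszul d x = (\<Sum>i\<in>A. ((- 1) powi (d * i)) *\<^sub>C component x i)"
  unfolding koszul_def by (rule sum.mono_neutral_left) (use assms in auto)

lemma component_add: "component (x + y) = (\<lambda>i. component x i + component y i)"
proof (rule component_eqI)
  let ?A = "{i. component x i \<noteq> 0} \<union> {i. component y i \<noteq> 0}"
  show "component x i + component y i \<in> G i" for i
    using component(1) subspace_component subspace_add by blast
  show A: "finite ?A" using component(2) by blast
  show "component x i + component y i = 0" if "i \<notin> ?A" for i using that by auto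
  show "x + y = (\<Sum>i\<in>?A. component x i + component y i)"
    using component_sum[OF A, of x] component_sum[OF A, of y] by (simp add: sum.distrib)
qed

lemma component_scale: "component (a *\<^sub>C x) = (\<lambda>i. a *\<^sub>C component x i)"
proof (rule component_eqI)
  show "a *\<^sub>C component x i \<in> G i" for i
    using component(1) subspace_component subspace_scale by blast
  show "finite {i. component x i \<noteq> 0}" by (rule component)
  show "a *\<^sub>C component x i = 0" if "i \<notin> {i. component x i \<noteq> 0}" for i using that by auto
  show "a *\<^sub>C x = (\<Sum>i | component x i \<noteq> 0. a *\<^sub>C component x i)"
    using component(3)[of x] by (metis scale_sum_right)
qed

lemma linear_koszul: "Vector_Spaces.linear scale scale (koszul d)"
proof -
  have "koszul d (x + y) = koszul d x + koszul d y" for x y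
  proof -
    let ?A = "{i. component x i \<noteq> 0} \<union> {i. component y i \<noteq> 0}"
    have A: "finite ?A" using component(2) by blast
    have s: "{i. component (x + y) i \<noteq> 0} \<subseteq> ?A" by (auto simp: component_add)
    show ?thesis
      using koszul_eq[OF A s, of d] koszul_eq[OF A, of x d] koszul_eq[OF A, of y d]
      by (simp add: component_add scale_right_distrib sum.distrib)
  qed
  moreover have "koszul d (a *\<^sub>C x) = a *\<^sub>C koszul d x" for a x
  proof -
    have s: "{i. component (a *\<^sub>C x) i \<noteq> 0} \<subseteq> {i. component x i \<noteq> 0}"
      by (auto simp: component_scale)
    show ?thesis
      using koszul_eq[OF component(2)[of x] s, of d]
      by (simp add: koszul_def component_scale scale_sum_right mult.commute)
  qed
  ultimately show ?thesis by unfold_locales auto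
qed

lemma koszul_homogeneous:
  assumes "x \<in> G i"
  shows "koszul d x = ((- 1) powi (d * i)) *\<^sub>C x"
proof -
  have c: "component x = (\<lambda>j. if j = i then x else 0)"
    by (rule component_eqI[of _ "{i}"]) (use assms subspace_0[OF subspace_component] in auto)
  then show ?thesis by (subst koszul_eq[of "{i}"]) (auto simp: c)
qed

lemma multilinear_id_tensor_id:
  assumes f: "Vector_Spaces.linear scale tensor_scale f" "\<And>x. f x \<in> tensor_power s"
  shows "multilinear scale tensor_scale (r + 1 + t)
    (\<lambda>xs. tensor_insert s (map (koszul d) (take r xs)) (drop (Suc r) xs) (f (xs ! r)))"
  unfolding multilinear_def
proof (intro allI impI)
  fix us vs :: "'v list"
  assume len: "Suc (length us + length vs) = r + 1 + t"
  have ins: "Vector_Spaces.linear scale tensor_scale (\<lambda>x. tensor_insert s (F x) (H x) a)"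
    if a: "a \<in> tensor_power s"
      and lin: "\<And>zs. Vector_Spaces.linear scale tensor_scale (\<lambda>x. ptensor (F x @ zs @ H x))"
    for F H a
  proof -
    have add: "tensor_insert s (F (x + y)) (H (x + y)) a
      = tensor_insert s (F x) (H x) a + tensor_insert s (F y) (H y) a" for x y
    proof (rule tensor_power_linear_eq[OF linear_tensor_insert _ _ a])
      show "Vector_Spaces.linear tensor_scale tensor_scale
        (\<lambda>a. tensor_insert s (F x) (H x) a + tensor_insert s (F y) (H y) a)"
        by (intro vector_space_pair.linear_compose_add linear_tensor_insert vector_space_pair.intro
            tensor.vector_space_axioms)
      fix zs :: "'v list" assume len: "length zs = s"
      interpret L: Vector_Spaces.linear scale tensor_scale "\<lambda>x. ptensor (F x @ zs @ H x)"
        by (rule lin)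
      show "tensor_insert s (F (x + y)) (H (x + y)) (ptensor zs)
        = tensor_insert s (F x) (H x) (ptensor zs) + tensor_insert s (F y) (H y) (ptensor zs)"
        using len by (simp add: tensor_insert_ptensor L.add)
    qed
    have scal: "tensor_insert s (F (c *\<^sub>C x)) (H (c *\<^sub>C x)) a = c *\<^sub>T tensor_insert s (F x) (H x) a"
      for c x
    proof (rule tensor_power_linear_eq[OF linear_tensor_insert _ _ a])
      show "Vector_Spaces.linear tensor_scale tensor_scale (\<lambda>a. c *\<^sub>T tensor_insert s (F x) (H x) a)"
        by (intro vector_space_pair.linear_compose_scale_right linear_tensor_insert
            vector_space_pair.intro tensor.vector_space_axioms)
      fix zs :: "'v list" assume len: "length zs = s"
      interpret L: Vector_Spaces.linear scale tensor_scale "\<lambda>x. ptensor (F x @ zs @ H x)"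
        by (rule lin)
      show "tensor_insert s (F (c *\<^sub>C x)) (H (c *\<^sub>C x)) (ptensor zs)
        = c *\<^sub>T tensor_insert s (F x) (H x) (ptensor zs)"
        using len by (simp add: tensor_insert_ptensor L.scale)
    qed
    show ?thesis by unfold_locales (auto simp: add scal)
  qed
  have pl: "Vector_Spaces.linear scale tensor_scale (\<lambda>x. ptensor (as @ x # bs))" for as bs
    using multilinear_ptensor[of "Suc (length as + length bs)"] unfolding multilinear_def by blast
  let ?F = "\<lambda>xs. tensor_insert s (map (koszul d) (take r xs)) (drop (Suc r) xs) (f (xs ! r))"
  consider "length us = r" | "length us < r" | "length us > r" by linarith
  then show "Vector_Spaces.linear scale tensor_scale (\<lambda>x. ?F (us @ x # vs))"
  proof cases
    case 1
    then show ?thesis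
      using Vector_Spaces.linear_compose[OF f(1) linear_tensor_insert] by (simp add: o_def nth_append)
  next
    case 2
    then obtain m where m: "r - length us = Suc m" by (metis Suc_diff_Suc)
    let ?k = "map (koszul d)"
    have eq: "?F (us @ x # vs) =
      tensor_insert s (?k us @ koszul d x # ?k (take m vs)) (drop (Suc m) vs) (f (vs ! m))" for x
      using 2 m by (simp add: nth_append Suc_diff_le)
    show ?thesis unfolding eq
      by (rule ins[OF f(2)])
         (use Vector_Spaces.linear_compose[OF linear_koszul pl] in \<open>simp add: o_def\<close>)
  next
    case 3
    then obtain m where m: "length us = Suc r + m" by (metis less_iff_Suc_add add_Suc)
    have eq: "?F (us @ x # vs) =
      tensor_insert s (map (koszul d) (take r us)) (drop (Suc r) us @ x # vs) (f (us ! r))" for x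
      using m by (simp add: nth_append)
    show ?thesis unfolding eq
      by (rule ins[OF f(2)]) (use pl[of "_ @ _ @ drop (Suc r) us"] in simp)
  qed
qed

lemma
  assumes "Vector_Spaces.linear scale tensor_scale f" "\<And>x. f x \<in> tensor_power s"
  shows linear_id_tensor_id:
      "Vector_Spaces.linear tensor_scale tensor_scale (id_tensor_id r s d f t)"
    and id_tensor_id_ptensor: "length xs = r \<Longrightarrow> length ys = t \<Longrightarrow>
      id_tensor_id r s d f t (ptensor (xs @ x # ys)) = tensor_insert s (map (koszul d) xs) ys (f x)"
proof -
  note lift = linear_tensor_lift tensor_lift_ptensor
  note lift = lift[OF tensor.vector_space_axioms multilinear_id_tensor_id[OF assms, of r t d]]
  show "Vector_Spaces.linear tensor_scale tensor_scale (id_tensor_id r s d f t)"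
    unfolding id_tensor_id_def by (rule lift(1))
  show "id_tensor_id r s d f t (ptensor (xs @ x # ys)) = tensor_insert s (map (koszul d) xs) ys (f x)"
    if "length xs = r" "length ys = t"
    using that lift(2)[of "xs @ x # ys"] by (simp add: id_tensor_id_def nth_append)
qed

lemma ptensor_map_koszul:
  "list_all2 (\<lambda>x i. x \<in> G i) xs ds \<Longrightarrow>
    ptensor (as @ map (koszul d) xs @ bs) = ((- 1) powi (d * sum_list ds)) *\<^sub>T ptensor (as @ xs @ bs)"
proof (induction arbitrary: as rule: list_all2_induct)
  case (Cons x xs i ds)
  interpret L: Vector_Spaces.linear scale tensor_scale
      "\<lambda>x. ptensor (as @ x # map (koszul d) xs @ bs)"
    using multilinear_ptensor[of "Suc (length as + length (map (koszul d) xs @ bs))"]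
    unfolding multilinear_def by blast
  show ?case
    using Cons.IH[of "as @ [x]"] Cons.hyps
    by (simp add: koszul_homogeneous L.scale power_int_add distrib_left)
qed simp

lemma id_tensor_id_homogeneous:
  assumes f: "Vector_Spaces.linear scale tensor_scale f" "\<And>x. f x \<in> tensor_power s"
    and "length xs = r" "length ys = t" and xs: "list_all2 (\<lambda>x i. x \<in> G i) xs ds"
  shows "id_tensor_id r s d f t (ptensor (xs @ x # ys))
    = ((- 1) powi (d * sum_list ds)) *\<^sub>T tensor_insert s xs ys (f x)"
  unfolding id_tensor_id_ptensor[OF f assms(3,4)]
proof (rule tensor_power_linear_eq[OF linear_tensor_insert _ _ f(2)])
  show "Vector_Spaces.linear tensor_scale tensor_scale
    (\<lambda>a. ((- 1) powi (d * sum_list ds)) *\<^sub>T tensor_insert s xs ys a)"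
    by (intro vector_space_pair.linear_compose_scale_right linear_tensor_insert
        vector_space_pair.intro tensor.vector_space_axioms)
  show "tensor_insert s (map (koszul d) xs) ys (ptensor zs)
    = ((- 1) powi (d * sum_list ds)) *\<^sub>T tensor_insert s xs ys (ptensor zs)" if "length zs = s" for zs
    using that ptensor_map_koszul[OF xs, of "[]" d "zs @ ys"] by (simp add: tensor_insert_ptensor)
qed

end


section \<open>Homotopy coalgebras\<close>

text \<open>\<open>\<Delta> k\<close> is only relevant for \<open>k \<ge> 1\<close>.  The map \<open>\<Delta> s\<close> has degree \<open>s - 2\<close>, which
  enters the Koszul sign.\<close>

locale A_infinity_coalgebra = graded_vector_space scale G
  for scale :: "'k::field_char_0 \<Rightarrow> 'v::ab_group_add \<Rightarrow> 'v" and G :: "int \<Rightarrow> 'v set" +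
  fixes \<Delta> :: "nat \<Rightarrow> 'v \<Rightarrow> ('k, 'v) tensor"
  assumes graded_linear: "k \<ge> 1 \<Longrightarrow> graded_linear_map k (int k - 2) (\<Delta> k)"
    and A_infinity_relation: "n \<ge> 1 \<Longrightarrow>
      (\<Sum>(r, s, t) \<in> {(r, s, t). r + s + t = n \<and> s \<ge> 1}.
        ((- 1) ^ (r * s + t)) *\<^sub>T id_tensor_id r s (int s - 2) (\<Delta> s) t (\<Delta> (r + 1 + t) x)) = 0"

text \<open>The label \<open>[r]\<close> is the number \<open>r\<close>, and the vector space with basis \<open>C\<^sub>n\<close> consists of the
  finitely supported functions \<open>nat \<Rightarrow>\<^sub>0 'k\<close> with support in \<open>{1..n}\<close>.\<close>

definition R0 :: "nat \<Rightarrow> nat \<Rightarrow> nat \<Rightarrow> nat \<Rightarrow> nat"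
  where "R0 m i n r =
    (if r \<le> i - 1 then r else if r \<le> i + n - 1 then i else r - n + 1)"

definition R1 :: "nat \<Rightarrow> nat \<Rightarrow> nat \<Rightarrow> nat \<Rightarrow> (nat \<Rightarrow>\<^sub>0 'k::field_char_0)"
  where "R1 m i n r =
    (if i \<le> r \<and> r \<le> i + n - 1 then Poly_Mapping.single (r - i + 1) 1
     else (\<Sum>j = 1..n. Poly_Mapping.single j 1))"

text \<open>The extension of \<open>[r] \<mapsto> \<Delta>\<^bsub>k,[r]\<^esub>\<close> to linear combinations of labels.\<close>

definition label_extension ::
    "(nat \<Rightarrow> nat \<Rightarrow> 'v \<Rightarrow> ('k::field_char_0, 'v) tensor) \<Rightarrow> nat \<Rightarrow> (nat \<Rightarrow>\<^sub>0 'k) \<Rightarrow> 'v \<Rightarrow> ('k, 'v) tensor"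
  where "label_extension \<Delta> k v x = (\<Sum>r = 1..k. Poly_Mapping.lookup v r *\<^sub>T \<Delta> k r x)"

locale Dend_infinity_coalgebra = graded_vector_space scale G
  for scale :: "'k::field_char_0 \<Rightarrow> 'v::ab_group_add \<Rightarrow> 'v" and G :: "int \<Rightarrow> 'v set" +
  fixes \<Delta> :: "nat \<Rightarrow> nat \<Rightarrow> 'v \<Rightarrow> ('k, 'v) tensor"
  assumes graded_linear: "k \<ge> 1 \<Longrightarrow> r \<in> {1..k} \<Longrightarrow> graded_linear_map k (int k - 2) (\<Delta> k r)"
    and Dend_infinity_relation: "n \<ge> 1 \<Longrightarrow> \<theta> \<in> {1..n} \<Longrightarrow>
      (\<Sum>(r, s, t) \<in> {(r, s, t). r + s + t = n \<and> s \<ge> 1}.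
        ((- 1) ^ (r * s + t)) *\<^sub>T
          id_tensor_id r s (int s - 2) (label_extension \<Delta> s (R1 (r + 1 + t) (r + 1) s \<theta>)) t
            (\<Delta> (r + 1 + t) (R0 (r + 1 + t) (r + 1) s \<theta>) x)) = 0"

end

theory Submission
  imports Defs
begin

text \<open>
  The \<open>A\<^sub>\<infinity>\<close> relation of order \<open>n\<close> is the sum of the \<open>Dend\<^sub>\<infinity>\<close> relations of order \<open>n\<close> over all
  labels \<open>\<theta> \<in> {1..n}\<close>, and this already holds separately for each summand \<open>(r, s, t)\<close>.

  Think of \<open>\<theta>\<close> as one of the \<open>n = r + s + t\<close> outputs obtained by splitting output \<open>r + 1\<close> of an
  operation with \<open>r + 1 + t\<close> outputs into \<open>s\<close> outputs.  If \<open>\<theta>\<close> lies outside the block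
  \<open>{r + 1..r + s}\<close>, the inner operation carries the label \<open>[1] + \<cdots> + [s]\<close>, hence is the full
  \<open>\<triangle>\<^sub>s\<close>, while the outer label \<open>R\<^sub>0 \<theta>\<close> runs exactly once through every label except \<open>r + 1\<close>.
  If \<open>\<theta>\<close> lies inside the block, the outer label is \<open>r + 1\<close> throughout, while the inner label runs
  exactly once through \<open>1, \<dots>, s\<close>, so that these terms add up to \<open>\<triangle>\<^sub>s\<close> after \<open>\<triangle>\<close> with label
  \<open>r + 1\<close>, the one case that was missing (\<open>sum_over_labels\<close>).  As \<open>id \<otimes> f \<otimes> id\<close> is additive in
  \<open>f\<close> (\<open>id_tensor_id_sum\<close>) and linear in its argument, all terms together are
  \<open>(id \<otimes> \<triangle>\<^sub>s \<otimes> id) \<circ> \<triangle>\<^bsub>r+1+t\<^esub>\<close>.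
\<close>

lemma linear_sum:
  assumes "vector_space scaleV" "vector_space scaleW"
    and "\<And>j. j \<in> J \<Longrightarrow> Vector_Spaces.linear scaleV scaleW (f j)"
  shows "Vector_Spaces.linear scaleV scaleW (\<lambda>x. \<Sum>j\<in>J. f j x)"
  by (rule vector_space_pair.linear_compose_sum[OF vector_space_pair.intro]) (use assms in auto)

text \<open>The combinatorial core.  The label \<open>\<theta>\<close> passes below, through and above the block of outputs
  of the inner operation; the first and the last range together give the outer labels other than
  \<open>r + 1\<close>.\<close>

lemma sum_over_labels:
  fixes F :: "(nat \<Rightarrow>\<^sub>0 'k::field_char_0) \<Rightarrow> nat \<Rightarrow> 'w::ab_group_add"
  shows "(\<Sum>\<theta> = 1..r + s + t. F (R1 (r + 1 + t) (r + 1) s \<theta>) (R0 (r + 1 + t) (r + 1) s \<theta>))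
    = (\<Sum>j \<in> {1..r + 1 + t} - {r + 1}. F (\<Sum>q = 1..s. Poly_Mapping.single q 1) j)
      + (\<Sum>q = 1..s. F (Poly_Mapping.single q 1) (r + 1))"
proof -
  let ?g = "\<lambda>\<theta>. F (R1 (r + 1 + t) (r + 1) s \<theta>) (R0 (r + 1 + t) (r + 1) s \<theta>)"
  let ?all = "\<Sum>q = 1..s. Poly_Mapping.single q (1::'k)"
  have split: "sum ?g {1..r + s + t}
      = sum ?g {1..r} + sum ?g {r + 1..r + s} + sum ?g {r + s + 1..r + s + t}"
    by (simp only: sum.ub_add_nat[of 1 r ?g s] sum.ub_add_nat[of 1 "r + s" ?g t] le_add2)
  have below: "sum ?g {1..r} = (\<Sum>j = 1..r. F ?all j)"
    by (rule sum.cong) (auto simp: R0_def R1_def)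
  have inside: "sum ?g {r + 1..r + s} = (\<Sum>q = 1..s. F (Poly_Mapping.single q 1) (r + 1))"
    by (rule sum.reindex_bij_witness[of _ "\<lambda>q. r + q" "\<lambda>\<theta>. \<theta> - r"])
       (auto simp: R0_def R1_def Suc_diff_Suc Suc_le_eq)
  have above: "sum ?g {r + s + 1..r + s + t} = (\<Sum>j = r + 2..r + 1 + t. F ?all j)"
    by (rule sum.reindex_bij_witness[of _ "\<lambda>j. j + s - 1" "\<lambda>\<theta>. \<theta> + 1 - s"])
       (auto simp: R0_def R1_def Suc_diff_le)
  have "{1..r + 1 + t} - {r + 1} = {1..r} \<union> {r + 2..r + 1 + t}" by auto
  then have "(\<Sum>j \<in> {1..r + 1 + t} - {r + 1}. F ?all j)
      = (\<Sum>j = 1..r. F ?all j) + (\<Sum>j = r + 2..r + 1 + t. F ?all j)"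
    by (simp add: sum.union_disjoint)
  then show ?thesis unfolding split below inside above by (simp add: algebra_simps)
qed

lemma label_extension_single:
  assumes "q \<in> {1..k}"
  shows "label_extension \<Delta> k (Poly_Mapping.single q 1) = \<Delta> k q"
proof
  fix x
  have "label_extension \<Delta> k (Poly_Mapping.single q 1) x
      = (\<Sum>r = 1..k. if r = q then \<Delta> k r x else 0)"
    unfolding label_extension_def by (rule sum.cong) (auto simp: lookup_single when_def)
  then show "label_extension \<Delta> k (Poly_Mapping.single q 1) x = \<Delta> k q x"
    using assms by simp
qed

lemma label_extension_all:
  "label_extension \<Delta> k (\<Sum>q = 1..k. Poly_Mapping.single q 1) = (\<lambda>x. \<Sum>r = 1..k. \<Delta> k r x)"
  unfolding label_extension_def
  by (intro ext sum.cong refl) (simp add: lookup_sum lookup_single when_def)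

context graded_vector_space
begin

lemma graded_linear_map_sum:
  assumes "\<And>j. j \<in> J \<Longrightarrow> graded_linear_map k d (f j)"
  shows "graded_linear_map k d (\<lambda>x. \<Sum>j\<in>J. f j x)"
  unfolding graded_linear_map_def tensor_power_def tensor_power_degree_def
  using assms
  by (auto simp: graded_linear_map_def tensor_power_def tensor_power_degree_def
      intro!: linear_sum vector_space_axioms tensor.vector_space_axioms tensor.span_sum)

text \<open>Both sides are linear in the tensor, so it suffices to compare them on pure tensors, where
  the claim reduces to linearity of inserting a tensor between fixed factors.\<close>

lemma id_tensor_id_sum:
  assumes f: "\<And>j. j \<in> J \<Longrightarrow> Vector_Spaces.linear scale tensor_scale (f j)"
      "\<And>j x. j \<in> J \<Longrightarrow> f j x \<in> tensor_power s"
    and a: "a \<in> tensor_power (r + 1 + t)"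
  shows "id_tensor_id r s d (\<lambda>x. \<Sum>j\<in>J. f j x) t a = (\<Sum>j\<in>J. id_tensor_id r s d (f j) t a)"
proof (rule tensor_power_linear_eq[OF _ _ _ a])
  have sum_linear: "Vector_Spaces.linear scale tensor_scale (\<lambda>x. \<Sum>j\<in>J. f j x)"
    by (intro linear_sum vector_space_axioms tensor.vector_space_axioms f)
  have sum_power: "(\<Sum>j\<in>J. f j x) \<in> tensor_power s" for x
    using f(2) unfolding tensor_power_def by (intro tensor.span_sum)
  show "Vector_Spaces.linear tensor_scale tensor_scale
      (id_tensor_id r s d (\<lambda>x. \<Sum>j\<in>J. f j x) t)"
    by (rule linear_id_tensor_id[OF sum_linear sum_power])
  show "Vector_Spaces.linear tensor_scale tensor_scale (\<lambda>a. \<Sum>j\<in>J. id_tensor_id r s d (f j) t a)"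
    by (intro linear_sum tensor.vector_space_axioms linear_id_tensor_id f)
  fix zs :: "'v list"
  assume len: "length zs = r + 1 + t"
  define xs x ys where "xs = take r zs" and "x = zs ! r" and "ys = drop (Suc r) zs"
  have zs: "zs = xs @ x # ys" "length xs = r" "length ys = t"
    using len by (simp_all add: xs_def x_def ys_def id_take_nth_drop[symmetric])
  interpret I: Vector_Spaces.linear tensor_scale tensor_scale
      "tensor_insert s (map (koszul d) xs) ys"
    by (rule linear_tensor_insert)
  show "id_tensor_id r s d (\<lambda>x. \<Sum>j\<in>J. f j x) t (ptensor zs)
      = (\<Sum>j\<in>J. id_tensor_id r s d (f j) t (ptensor zs))"
    unfolding zs(1) id_tensor_id_ptensor[OF sum_linear sum_power zs(2,3)]
    by (simp add: I.sum id_tensor_id_ptensor[OF f zs(2,3)])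
qed

end

context Dend_infinity_coalgebra
begin

lemma graded_linear_sum_labels:
  "k \<ge> 1 \<Longrightarrow> graded_linear_map k (int k - 2) (\<lambda>x. \<Sum>r = 1..k. \<Delta> k r x)"
  by (intro graded_linear_map_sum graded_linear)

lemma sum_labels_id_tensor_id:
  assumes s: "s \<ge> 1"
  shows "(\<Sum>\<theta> = 1..r + s + t.
      id_tensor_id r s (int s - 2) (label_extension \<Delta> s (R1 (r + 1 + t) (r + 1) s \<theta>)) t
        (\<Delta> (r + 1 + t) (R0 (r + 1 + t) (r + 1) s \<theta>) x))
    = id_tensor_id r s (int s - 2) (\<lambda>x. \<Sum>q = 1..s. \<Delta> s q x) t
        (\<Sum>j = 1..r + 1 + t. \<Delta> (r + 1 + t) j x)"
proof -
  let ?m = "r + 1 + t"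
  let ?I = "\<lambda>f. id_tensor_id r s (int s - 2) f t"
  let ?S = "\<lambda>x. \<Sum>q = 1..s. \<Delta> s q x"
  have S: "Vector_Spaces.linear scale tensor_scale ?S" "\<And>x. ?S x \<in> tensor_power s"
    using graded_linear_sum_labels[OF s] by (auto simp: graded_linear_map_def)
  interpret I: Vector_Spaces.linear tensor_scale tensor_scale "?I ?S"
    by (rule linear_id_tensor_id[OF S])
  have \<Delta>_s: "Vector_Spaces.linear scale tensor_scale (\<Delta> s q)" "\<Delta> s q x \<in> tensor_power s"
    if "q \<in> {1..s}" for q x
    using graded_linear[OF s that] by (auto simp: graded_linear_map_def)
  have \<Delta>_m: "\<Delta> ?m (r + 1) x \<in> tensor_power ?m"
    using graded_linear[of ?m "r + 1"] by (auto simp: graded_linear_map_def)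
  have "(\<Sum>\<theta> = 1..r + s + t. ?I (label_extension \<Delta> s (R1 ?m (r + 1) s \<theta>))
        (\<Delta> ?m (R0 ?m (r + 1) s \<theta>) x))
      = (\<Sum>j \<in> {1..?m} - {r + 1}. ?I ?S (\<Delta> ?m j x))
        + (\<Sum>q = 1..s. ?I (\<Delta> s q) (\<Delta> ?m (r + 1) x))"
    unfolding sum_over_labels[where F = "\<lambda>v j. ?I (label_extension \<Delta> s v) (\<Delta> ?m j x)"]
      label_extension_all
    by (intro arg_cong2[where f = plus] sum.cong refl) (simp_all add: label_extension_single)
  also have "(\<Sum>q = 1..s. ?I (\<Delta> s q) (\<Delta> ?m (r + 1) x)) = ?I ?S (\<Delta> ?m (r + 1) x)"
    by (rule id_tensor_id_sum[OF \<Delta>_s \<Delta>_m, symmetric])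
  also have "(\<Sum>j \<in> {1..?m} - {r + 1}. ?I ?S (\<Delta> ?m j x)) + ?I ?S (\<Delta> ?m (r + 1) x)
      = (\<Sum>j = 1..?m. ?I ?S (\<Delta> ?m j x))"
    by (subst add.commute, rule sum.remove[symmetric]) simp_all
  also have "\<dots> = ?I ?S (\<Sum>j = 1..?m. \<Delta> ?m j x)"
    by (rule I.sum[symmetric])
  finally show ?thesis .
qed

end

theorem theorem5p8:
  fixes scale :: "'k::field_char_0 \<Rightarrow> 'v::ab_group_add \<Rightarrow> 'v"
    and G :: "int \<Rightarrow> 'v set"
    and \<Delta> :: "nat \<Rightarrow> nat \<Rightarrow> 'v \<Rightarrow> ('k, 'v) tensor"
  assumes "Dend_infinity_coalgebra scale G \<Delta>"
  shows "A_infinity_coalgebra scale G (\<lambda>k x. \<Sum>r = 1..k. \<Delta> k r x)"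
proof -
  interpret Dend_infinity_coalgebra scale G \<Delta> by fact
  show ?thesis
  proof
    show "graded_linear_map k (int k - 2) (\<lambda>x. \<Sum>r = 1..k. \<Delta> k r x)" if "k \<ge> 1" for k
      by (rule graded_linear_sum_labels[OF that])
    fix n :: nat and x
    assume n: "n \<ge> 1"
    let ?N = "{(r, s, t). r + s + t = n \<and> s \<ge> 1}"
    let ?D = "\<lambda>(r, s, t) \<theta>. ((- 1) ^ (r * s + t)) *\<^sub>T
          id_tensor_id r s (int s - 2) (label_extension \<Delta> s (R1 (r + 1 + t) (r + 1) s \<theta>)) t
            (\<Delta> (r + 1 + t) (R0 (r + 1 + t) (r + 1) s \<theta>) x)"
    let ?A = "\<lambda>(r, s, t). ((- 1) ^ (r * s + t)) *\<^sub>T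
          id_tensor_id r s (int s - 2) (\<lambda>x. \<Sum>q = 1..s. \<Delta> s q x) t
            (\<Sum>j = 1..r + 1 + t. \<Delta> (r + 1 + t) j x)"
    have "(\<Sum>p \<in> ?N. ?A p) = (\<Sum>p \<in> ?N. \<Sum>\<theta> = 1..n. ?D p \<theta>)"
    proof (rule sum.cong[OF refl])
      fix p
      assume "p \<in> ?N"
      then obtain r s t where p: "p = (r, s, t)" and s: "s \<ge> 1" and n: "n = r + s + t" by auto
      show "?A p = (\<Sum>\<theta> = 1..n. ?D p \<theta>)"
        unfolding p n prod.case sum_labels_id_tensor_id[OF s, symmetric]
        by (rule tensor.scale_sum_right)
    qed
    also have "\<dots> = (\<Sum>\<theta> = 1..n. \<Sum>p \<in> ?N. ?D p \<theta>)"
      by (rule sum.swap)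
    also have "\<dots> = 0"
      using Dend_infinity_relation[OF n] by (intro sum.neutral) (auto simp: case_prod_unfold)
    finally show "(\<Sum>p \<in> ?N. ?A p) = 0" .
  qed
qed

end
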